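(* Let $(X_t)_{t\in\mathbb{Z}}$ be a strictly stationary $\mathbb{R}^d$-valued process with marginal distribution $P^0$. Assume that $k(x,y)=F(\|x-y\|)$ where $F(a)=\int_a^\infty f(b)\,\mathrm{d}b$ for some nonnegative continuous function $f$ with $\int_0^\infty f(b)\,\mathrm{d}b=1$. Then for every $t\ge1$, $$\varrho_t\le\beta(\sigma(X_0),\sigma(X_t))\le\beta_t.$$
   Context: $k:\mathbb{R}^d\times\mathbb{R}^d\to\mathbb{R}$ is a symmetric positive definite characteristic kernel with $|k|\le1$, with RKHS $\mathcal{H}_k$; $\mu_P=\mathbb{E}_{X\sim P}[k(X,\cdot)]\in\mathcal{H}_k$ for a probability measure $P$ on $\mathbb{R}^d$. $\|\cdot\|$ in the formula for $k$ is the Euclidean norm. $\varrho_t=\left|\mathbb{E}\left\langle k(X_t,\cdot)-\mu_{P^0},\,k(X_0,\cdot)-\mu_{P^0}\right\rangle_{\mathcal{H}_k}\right|$. For two sub-$\sigma$-algebras $\mathcal{A},\mathcal{B}$ of the underlying probability space, $$\beta(\mathcal{A},\mathcal{B})=\frac12\sup\sum_{i=1}^I\sum_{j=1}^J|\mathbb{P}(U_i\cap V_j)-\mathbb{P}(U_i)\mathbb{P}(V_j)|,$$ where the supremum is over $I,J\ge1$, all finite partitions $(U_1,\dots,U_I)$ of the sample space with $U_i\in\mathcal{A}$, and all finite partitions $(V_1,\dots,V_J)$ of the sample space with $V_j\in\mathcal{B}$. The $\beta$-mixing coefficients of the process are $\beta_t=\beta(\sigma(X_0,X_{-1},\dots),\sigma(X_t,X_{t+1},\dots))$.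 *)

theory Defs
  imports "HOL-Probability.Probability"
begin

section \<open>Kernels, reproducing kernel Hilbert spaces, mean embeddings\<close>

text \<open>Positive definiteness is meant in the usual sense of kernel methods: all Gram matrices
  are positive semidefinite.\<close>

definition pos_def_kernel :: "('x \<Rightarrow> 'x \<Rightarrow> real) \<Rightarrow> bool" where
  "pos_def_kernel k \<longleftrightarrow>
     (\<forall>x y. k x y = k y x) \<and>
     (\<forall>S c. finite S \<longrightarrow> 0 \<le> (\<Sum>x\<in>S. \<Sum>y\<in>S. c x * c y * k x y))"

text \<open>The RKHS of \<open>k\<close> is a Hilbert space of functions, depending on \<open>k\<close>. It is given by a Hilbert
  space type \<open>'h\<close> together with the injection \<open>\<iota>\<close> that sends an element of \<open>'h\<close> to the function
  it represents. The sections \<open>k x\<close> belong to the space and reproduce point evaluation;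
  these conditions determine the RKHS up to a unique isometric isomorphism that respects \<open>\<iota>\<close>.
  Separability (class \<open>second_countable_topology\<close>) is required by the Bochner integral; it is
  automatic for a continuous kernel on a separable space.\<close>

definition kernel_section ::
    "('x \<Rightarrow> 'x \<Rightarrow> real) \<Rightarrow> ('h \<Rightarrow> 'x \<Rightarrow> real) \<Rightarrow> 'x \<Rightarrow> 'h" where
  "kernel_section k \<iota> x = inv \<iota> (k x)"

definition is_rkhs ::
    "('x \<Rightarrow> 'x \<Rightarrow> real) \<Rightarrow>
     ('h::{real_inner, banach, second_countable_topology} \<Rightarrow> 'x \<Rightarrow> real) \<Rightarrow> bool" where
  "is_rkhs k \<iota> \<longleftrightarrow>
     inj \<iota> \<and> (\<forall>x. linear (\<lambda>h. \<iota> h x)) \<and>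
     (\<forall>x. k x \<in> range \<iota>) \<and>
     (\<forall>h x. \<iota> h x = h \<bullet> kernel_section k \<iota> x)"

definition mean_embedding ::
    "('x \<Rightarrow> 'x \<Rightarrow> real) \<Rightarrow>
     ('h::{real_inner, banach, second_countable_topology} \<Rightarrow> 'x \<Rightarrow> real) \<Rightarrow> 'x measure \<Rightarrow> 'h" where
  "mean_embedding k \<iota> P = (\<integral>x. kernel_section k \<iota> x \<partial>P)"

definition characteristic_kernel ::
    "('x::topological_space \<Rightarrow> 'x \<Rightarrow> real) \<Rightarrow>
     ('h::{real_inner, banach, second_countable_topology} \<Rightarrow> 'x \<Rightarrow> real) \<Rightarrow> bool" where
  "characteristic_kernel k \<iota> \<longleftrightarrow>
     inj_on (mean_embedding k \<iota>) {P. prob_space P \<and> sets P = sets borel}"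

section \<open>Stationary processes and mixing coefficients\<close>

definition strictly_stationary ::
    "'w measure \<Rightarrow> (int \<Rightarrow> 'w \<Rightarrow> 'x::topological_space) \<Rightarrow> bool" where
  "strictly_stationary M X \<longleftrightarrow>
     (\<forall>t. X t \<in> borel_measurable M) \<and>
     (\<forall>J h. finite J \<longrightarrow>
        distr M (\<Pi>\<^sub>M j\<in>J. borel) (\<lambda>\<omega>. \<lambda>j\<in>J. X (j + h) \<omega>) =
        distr M (\<Pi>\<^sub>M j\<in>J. borel) (\<lambda>\<omega>. \<lambda>j\<in>J. X j \<omega>))"

definition process_sigma ::
    "'w measure \<Rightarrow> (int \<Rightarrow> 'w \<Rightarrow> 'x::topological_space) \<Rightarrow> int set \<Rightarrow> 'w set set" where
  "process_sigma M X T =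
     sigma_sets (space M) {X t -` B \<inter> space M | t B. t \<in> T \<and> B \<in> sets borel}"

definition finite_partition ::
    "'w measure \<Rightarrow> 'w set set \<Rightarrow> nat \<Rightarrow> (nat \<Rightarrow> 'w set) \<Rightarrow> bool" where
  "finite_partition M \<A> I U \<longleftrightarrow>
     I \<ge> 1 \<and> (\<forall>i\<in>{1..I}. U i \<in> \<A>) \<and>
     disjoint_family_on U {1..I} \<and> (\<Union>i\<in>{1..I}. U i) = space M"

text \<open>For sub-sigma-algebras of a probability space the set below is nonempty and bounded by 2,
  so the real-valued supremum is the genuine one.\<close>

definition beta_coeff :: "'w measure \<Rightarrow> 'w set set \<Rightarrow> 'w set set \<Rightarrow> real" where
  "beta_coeff M \<A> \<B> = 1 / 2 *
     Sup {(\<Sum>i=1..I. \<Sum>j=1..J. \<bar>measure M (U i \<inter> V j) - measure M (U i) * measure M (V j)\<bar>)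
          | I J U V. finite_partition M \<A> I U \<and> finite_partition M \<B> J V}"

definition beta_mixing ::
    "'w measure \<Rightarrow> (int \<Rightarrow> 'w \<Rightarrow> 'x::topological_space) \<Rightarrow> int \<Rightarrow> real" where
  "beta_mixing M X t = beta_coeff M (process_sigma M X {..0}) (process_sigma M X {t..})"

definition rho_coeff ::
    "('x \<Rightarrow> 'x \<Rightarrow> real) \<Rightarrow>
     ('h::{real_inner, banach, second_countable_topology} \<Rightarrow> 'x \<Rightarrow> real) \<Rightarrow>
     'x measure \<Rightarrow> 'w measure \<Rightarrow> (int \<Rightarrow> 'w \<Rightarrow> 'x) \<Rightarrow> int \<Rightarrow> real" where
  "rho_coeff k \<iota> P0 M X t =
     \<bar>\<integral>\<omega>. (kernel_section k \<iota> (X t \<omega>) - mean_embedding k \<iota> P0) \<bullet>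
          (kernel_section k \<iota> (X 0 \<omega>) - mean_embedding k \<iota> P0) \<partial>M\<bar>"

end

theory Submission
  imports Defs
begin

text \<open>Since \<open>f \<ge> 0\<close> and \<open>\<bar>k\<bar> \<le> 1\<close>, the kernel takes values in \<open>[0, 1]\<close>. Discretise the state
  space: for simple \<open>Y\<close> and \<open>Z\<close>, measurable with respect to the two sigma-algebras, the covariance
  of the feature vectors is \<open>\<Sum>i j. a i j * d i j\<close> with \<open>a i j \<in> [0, 1]\<close> values of the kernel and
  \<open>d i j = P(U i \<inter> V j) - P(U i) P(V j)\<close>. The \<open>d i j\<close> sum to zero, so \<open>a i j\<close> may be replaced by
  \<open>a i j - 1/2\<close>, which bounds the covariance by half of the sum of the \<open>\<bar>d i j\<bar>\<close>. The general case
  follows by dominated convergence, because the feature map is continuous: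
  \<open>\<parallel>\<phi> x - \<phi> y\<parallel>\<^sup>2 = 2 F 0 - 2 F \<parallel>x - y\<parallel>\<close>.\<close>

section \<open>Partition sums and the supremum behind \<open>beta_coeff\<close>\<close>

context prob_space
begin

lemma sum_prob_Int_finite_partition:
  assumes "finite_partition M \<A> I U" "\<A> \<subseteq> events" "C \<in> events"
  shows "(\<Sum>i=1..I. prob (U i \<inter> C)) = prob C"
proof -
  have "C = (\<Union>i\<in>{1..I}. U i \<inter> C)"
    using assms sets.sets_into_space[of C M] unfolding finite_partition_def by blast
  moreover have "prob (\<Union>i\<in>{1..I}. U i \<inter> C) = (\<Sum>i=1..I. prob (U i \<inter> C))"
  proof (rule finite_measure_finite_Union)
    show "(\<lambda>i. U i \<inter> C) ` {1..I} \<subseteq> events"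
      using assms unfolding finite_partition_def by auto
    show "disjoint_family_on (\<lambda>i. U i \<inter> C) {1..I}"
      using assms(1) unfolding finite_partition_def disjoint_family_on_def by blast
  qed simp
  ultimately show ?thesis by simp
qed

lemma sum_prob_finite_partition:
  assumes "finite_partition M \<A> I U" "\<A> \<subseteq> events"
  shows "(\<Sum>i=1..I. prob (U i)) = 1"
proof -
  have "U i \<inter> space M = U i" if "i \<in> {1..I}" for i
    using assms that sets.sets_into_space[of "U i" M] unfolding finite_partition_def by blast
  with sum_prob_Int_finite_partition[OF assms, of "space M"] show ?thesis
    by (simp add: prob_space)
qed

text \<open>Summing out one partition at a time leaves the total mass 1. The next lemma gives the
  same total for the product weights, so the differences of joint and product weights sum to zero,
  which is what allows weights to be shifted by a constant later.\<close>

lemma sum_prob_Int_finite_partitions: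
  assumes "finite_partition M \<A> I U" "\<A> \<subseteq> events" "finite_partition M \<B> J V" "\<B> \<subseteq> events"
  shows "(\<Sum>i=1..I. \<Sum>j=1..J. prob (U i \<inter> V j)) = 1"
proof -
  have V: "V j \<in> events" if "j \<in> {1..J}" for j
    using assms(3,4) that by (auto simp: finite_partition_def)
  have "(\<Sum>i=1..I. \<Sum>j=1..J. prob (U i \<inter> V j)) = (\<Sum>j=1..J. \<Sum>i=1..I. prob (U i \<inter> V j))"
    by (rule sum.swap)
  also have "\<dots> = (\<Sum>j=1..J. prob (V j))"
    using sum_prob_Int_finite_partition[OF assms(1,2) V] by simp
  also have "\<dots> = 1" by (rule sum_prob_finite_partition[OF assms(3,4)])
  finally show ?thesis .
qed

lemma sum_prob_prod_finite_partitions: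
  assumes "finite_partition M \<A> I U" "\<A> \<subseteq> events" "finite_partition M \<B> J V" "\<B> \<subseteq> events"
  shows "(\<Sum>i=1..I. \<Sum>j=1..J. prob (U i) * prob (V j)) = 1"
  unfolding sum_distrib_left[symmetric] sum_prob_finite_partition[OF assms(3,4)]
  using sum_prob_finite_partition[OF assms(1,2)] by simp

text \<open>A real \<open>Sup\<close> can be compared with its members only if the set is bounded.
  The triangle inequality bounds each term by the sum of a joint and a product weight, and either
  kind of weight has total mass 1, whence the bound 2.\<close>

lemma bdd_above_beta_coeff:
  assumes "\<A> \<subseteq> events" "\<B> \<subseteq> events"
  shows "bdd_above {(\<Sum>i=1..I. \<Sum>j=1..J. \<bar>prob (U i \<inter> V j) - prob (U i) * prob (V j)\<bar>)
          | I J U V. finite_partition M \<A> I U \<and> finite_partition M \<B> J V}"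
proof (rule bdd_aboveI[of _ 2], clarify)
  fix I J U V
  assume U: "finite_partition M \<A> I U" and V: "finite_partition M \<B> J V"
  have "(\<Sum>i=1..I. \<Sum>j=1..J. \<bar>prob (U i \<inter> V j) - prob (U i) * prob (V j)\<bar>)
      \<le> (\<Sum>i=1..I. \<Sum>j=1..J. prob (U i \<inter> V j) + prob (U i) * prob (V j))"
    by (intro sum_mono order_trans[OF abs_triangle_ineq4]) simp
  also have "\<dots> = 2"
    by (simp add: sum.distrib sum_prob_Int_finite_partitions[OF U assms(1) V assms(2), simplified]
        sum_prob_prod_finite_partitions[OF U assms(1) V assms(2), simplified])
  finally show "(\<Sum>i=1..I. \<Sum>j=1..J. \<bar>prob (U i \<inter> V j) - prob (U i) * prob (V j)\<bar>) \<le> 2" .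
qed

text \<open>A partition into sets of the smaller sigma-algebra is also one into sets of the larger,
  so the supremum runs over a larger set. The whole space must belong to the smaller families so
  that the one-piece partition exists and the smaller set is nonempty.\<close>

lemma beta_coeff_mono:
  assumes "\<A> \<subseteq> \<A>'" "\<B> \<subseteq> \<B>'" "\<A>' \<subseteq> events" "\<B>' \<subseteq> events" "space M \<in> \<A>" "space M \<in> \<B>"
  shows "beta_coeff M \<A> \<B> \<le> beta_coeff M \<A>' \<B>'"
proof -
  have triv: "finite_partition M \<C> 1 (\<lambda>_. space M)" if "space M \<in> \<C>" for \<C>
    using that by (auto simp: finite_partition_def disjoint_family_on_def)
  have mono: "finite_partition M \<C>' I U" if "finite_partition M \<C> I U" "\<C> \<subseteq> \<C>'" for \<C> \<C>' I U
    using that by (auto simp: finite_partition_def)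
  show ?thesis
    unfolding beta_coeff_def
  proof (intro mult_left_mono cSup_subset_mono bdd_above_beta_coeff assms)
    show "{(\<Sum>i=1..I. \<Sum>j=1..J. \<bar>prob (U i \<inter> V j) - prob (U i) * prob (V j)\<bar>)
          | I J U V. finite_partition M \<A> I U \<and> finite_partition M \<B> J V} \<noteq> {}"
      using triv[OF assms(5)] triv[OF assms(6)] by blast
    show "{(\<Sum>i=1..I. \<Sum>j=1..J. \<bar>prob (U i \<inter> V j) - prob (U i) * prob (V j)\<bar>)
          | I J U V. finite_partition M \<A> I U \<and> finite_partition M \<B> J V}
      \<subseteq> {(\<Sum>i=1..I. \<Sum>j=1..J. \<bar>prob (U i \<inter> V j) - prob (U i) * prob (V j)\<bar>)
          | I J U V. finite_partition M \<A>' I U \<and> finite_partition M \<B>' J V}"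
      using mono[OF _ assms(1)] mono[OF _ assms(2)] by blast
  qed simp
qed

text \<open>This is where the factor 1/2 of \<open>beta_coeff\<close> is matched: bounding the
  weights by 1 directly would lose a factor 2, whereas centred at the midpoint of [0, 1] they have
  absolute value at most 1/2.\<close>

lemma weighted_sum_le_beta_coeff:
  assumes "\<A> \<subseteq> events" "\<B> \<subseteq> events"
    and U: "finite_partition M \<A> I U" and V: "finite_partition M \<B> J V"
    and a: "\<And>i j. i \<in> {1..I} \<Longrightarrow> j \<in> {1..J} \<Longrightarrow> 0 \<le> a i j \<and> a i j \<le> 1"
  shows "\<bar>\<Sum>i=1..I. \<Sum>j=1..J. a i j * (prob (U i \<inter> V j) - prob (U i) * prob (V j))\<bar>
           \<le> beta_coeff M \<A> \<B>"
proof -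
  define d where "d i j = prob (U i \<inter> V j) - prob (U i) * prob (V j)" for i j
  have "(\<Sum>i=1..I. \<Sum>j=1..J. d i j) = 0"
    unfolding d_def sum_subtractf
    using sum_prob_Int_finite_partitions[OF U assms(1) V assms(2)]
      sum_prob_prod_finite_partitions[OF U assms(1) V assms(2)] by simp
  then have "(\<Sum>i=1..I. \<Sum>j=1..J. 1/2 * d i j) = 0"
    by (simp only: sum_distrib_left[symmetric])
  then have "(\<Sum>i=1..I. \<Sum>j=1..J. a i j * d i j) = (\<Sum>i=1..I. \<Sum>j=1..J. (a i j - 1/2) * d i j)"
    by (simp only: left_diff_distrib sum_subtractf diff_zero)
  also have "\<bar>\<dots>\<bar> \<le> (\<Sum>i=1..I. \<Sum>j=1..J. 1/2 * \<bar>d i j\<bar>)"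
  proof (intro order_trans[OF sum_abs] sum_mono)
    fix i j assume "i \<in> {1..I}" "j \<in> {1..J}"
    from a[OF this] have "\<bar>a i j - 1/2\<bar> \<le> 1/2" by linarith
    then show "\<bar>(a i j - 1/2) * d i j\<bar> \<le> 1/2 * \<bar>d i j\<bar>"
      unfolding abs_mult by (rule mult_right_mono) simp
  qed
  also have "\<dots> = 1/2 * (\<Sum>i=1..I. \<Sum>j=1..J. \<bar>d i j\<bar>)"
    by (simp only: sum_distrib_left)
  also have "\<dots> \<le> beta_coeff M \<A> \<B>"
    unfolding beta_coeff_def d_def
    by (intro mult_left_mono cSup_upper bdd_above_beta_coeff assms) (use U V in auto)
  finally show ?thesis by (simp add: d_def)
qed

section \<open>Covariances of feature vectors: simple variables, then the limit\<close>

text \<open>The pieces are the level sets. Enumerating the values by a bijection makes different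
  indices give disjoint pieces, and a probability space is nonempty, so there is at least one
  piece.\<close>

lemma simple_function_finite_partition:
  assumes "simple_function M Y" "\<And>y. Y -` {y} \<inter> space M \<in> \<A>"
  obtains I g where "bij_betw g {1..I} (Y ` space M)"
    and "finite_partition M \<A> I (\<lambda>i. Y -` {g i} \<inter> space M)"
proof -
  have fin: "finite (Y ` space M)" using assms(1) by (rule simple_functionD)
  then obtain g where g: "bij_betw g {1..card (Y ` space M)} (Y ` space M)"
    using ex_bij_betw_nat_finite_1 by blast
  have "card (Y ` space M) \<ge> 1"
    using fin not_empty by (simp add: Suc_le_eq card_gt_0_iff)
  moreover have "disjoint_family_on (\<lambda>i. Y -` {g i} \<inter> space M) {1..card (Y ` space M)}"
    unfolding disjoint_family_on_def
  proof (intro ballI impI)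
    fix i j assume "i \<in> {1..card (Y ` space M)}" "j \<in> {1..card (Y ` space M)}" "i \<noteq> j"
    then have "g i \<noteq> g j" using bij_betw_imp_inj_on[OF g] by (auto dest: inj_onD)
    then show "(Y -` {g i} \<inter> space M) \<inter> (Y -` {g j} \<inter> space M) = {}" by auto
  qed
  moreover have "(\<Union>i\<in>{1..card (Y ` space M)}. Y -` {g i} \<inter> space M) = space M"
  proof (intro equalityI subsetI)
    fix \<omega> assume "\<omega> \<in> space M"
    then obtain i where "i \<in> {1..card (Y ` space M)}" "g i = Y \<omega>"
      using bij_betw_imp_surj_on[OF g] by (metis imageE imageI)
    with \<open>\<omega> \<in> space M\<close> show "\<omega> \<in> (\<Union>i\<in>{1..card (Y ` space M)}. Y -` {g i} \<inter> space M)"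
      by (intro UN_I[of i]) simp_all
  qed auto
  ultimately show thesis using g assms(2) by (intro that) (auto simp: finite_partition_def)
qed

lemma sum_indicator_level_sets:
  fixes \<phi> :: "'x \<Rightarrow> 'h::real_vector"
  assumes "bij_betw g {1..I::nat} (Y ` space M)" "\<omega> \<in> space M"
  shows "\<phi> (Y \<omega>) = (\<Sum>i=1..I. indicat_real (Y -` {g i} \<inter> space M) \<omega> *\<^sub>R \<phi> (g i))"
proof -
  obtain i where i: "i \<in> {1..I}" "g i = Y \<omega>"
    using assms by (metis bij_betw_imp_surj_on imageE imageI)
  \<comment> \<open>Injectivity of \<open>g\<close> singles out the one level set that contains
    \<omega>; all other summands vanish.\<close>
  then have "indicat_real (Y -` {g j} \<inter> space M) \<omega> *\<^sub>R \<phi> (g j) = (if j = i then \<phi> (g i) else 0)"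
    if "j \<in> {1..I}" for j
    using that i assms(2) inj_onD[OF bij_betw_imp_inj_on[OF assms(1)], of i j]
    by (cases "j = i") (auto simp: indicator_def)
  then have "(\<Sum>j=1..I. indicat_real (Y -` {g j} \<inter> space M) \<omega> *\<^sub>R \<phi> (g j))
      = (\<Sum>j=1..I. if j = i then \<phi> (g i) else 0)"
    by (intro sum.cong refl)
  also have "\<dots> = \<phi> (Y \<omega>)" using i by simp
  finally show ?thesis ..
qed

text \<open>Only finitely many vectors \<open>\<phi> (g i)\<close> and \<open>\<phi> (h j)\<close>
  occur, so all three expectations become finite sums and the covariance is a weighted sum of
  discrepancies with weights \<open>\<phi> (g i) \<bullet> \<phi> (h j)\<close> in [0, 1].\<close>

lemma covariance_simple_le_beta_coeff:
  fixes \<phi> :: "'x \<Rightarrow> 'h::{real_inner, banach, second_countable_topology}"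
  assumes "\<A> \<subseteq> events" "\<B> \<subseteq> events"
    and Y: "simple_function M Y" "\<And>y. Y -` {y} \<inter> space M \<in> \<A>"
    and Z: "simple_function M Z" "\<And>z. Z -` {z} \<inter> space M \<in> \<B>"
    and \<phi>: "\<And>x y. 0 \<le> \<phi> x \<bullet> \<phi> y" "\<And>x y. \<phi> x \<bullet> \<phi> y \<le> 1"
  shows "\<bar>expectation (\<lambda>\<omega>. \<phi> (Y \<omega>) \<bullet> \<phi> (Z \<omega>))
            - expectation (\<lambda>\<omega>. \<phi> (Y \<omega>)) \<bullet> expectation (\<lambda>\<omega>. \<phi> (Z \<omega>))\<bar> \<le> beta_coeff M \<A> \<B>"
proof -
  obtain I g where g: "bij_betw g {1..I} (Y ` space M)"
    and gU: "finite_partition M \<A> I (\<lambda>i. Y -` {g i} \<inter> space M)"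
    using simple_function_finite_partition[OF Y] .
  obtain J h where h: "bij_betw h {1..J} (Z ` space M)"
    and hV: "finite_partition M \<B> J (\<lambda>i. Z -` {h i} \<inter> space M)"
    using simple_function_finite_partition[OF Z] .
  define U where "U i = Y -` {g i} \<inter> space M" for i
  define V where "V j = Z -` {h j} \<inter> space M" for j
  have U: "finite_partition M \<A> I U" and V: "finite_partition M \<B> J V"
    using gU hV unfolding U_def V_def .
  have UV_events[measurable]: "U i \<in> events" "V j \<in> events" for i j
    using Y(2) Z(2) assms(1,2) unfolding U_def V_def by blast+
  have Y_eq: "\<phi> (Y \<omega>) = (\<Sum>i=1..I. indicator (U i) \<omega> *\<^sub>R \<phi> (g i))"
    and Z_eq: "\<phi> (Z \<omega>) = (\<Sum>j=1..J. indicator (V j) \<omega> *\<^sub>R \<phi> (h j))" if "\<omega> \<in> space M" for \<omega>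
    using sum_indicator_level_sets[OF g that] sum_indicator_level_sets[OF h that]
    unfolding U_def V_def by auto
  have E_indicator: "expectation (\<lambda>\<omega>. \<Sum>i=1..n. indicat_real (A i) \<omega> *\<^sub>R x i)
      = (\<Sum>i=1..n. prob (A i) *\<^sub>R x i)"
    if [measurable]: "\<And>i. A i \<in> events" for A and x :: "nat \<Rightarrow> 'h" and n
  proof -
    have "expectation (\<lambda>\<omega>. \<Sum>i=1..n. indicat_real (A i) \<omega> *\<^sub>R x i)
        = (\<Sum>i=1..n. expectation (\<lambda>\<omega>. indicat_real (A i) \<omega> *\<^sub>R x i))"
      by (intro Bochner_Integration.integral_sum integrable_scaleR_left)
        (auto simp: emeasure_eq_measure)
    also have "\<dots> = (\<Sum>i=1..n. prob (A i) *\<^sub>R x i)"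
      by (intro sum.cong refl, subst integral_scaleR_left) (auto simp: emeasure_eq_measure)
    finally show ?thesis .
  qed
  have EY: "expectation (\<lambda>\<omega>. \<phi> (Y \<omega>)) = (\<Sum>i=1..I. prob (U i) *\<^sub>R \<phi> (g i))"
    by (simp only: Bochner_Integration.integral_cong[OF refl Y_eq] E_indicator UV_events)
  have EZ: "expectation (\<lambda>\<omega>. \<phi> (Z \<omega>)) = (\<Sum>j=1..J. prob (V j) *\<^sub>R \<phi> (h j))"
    by (simp only: Bochner_Integration.integral_cong[OF refl Z_eq] E_indicator UV_events)
  have YZ_eq: "\<phi> (Y \<omega>) \<bullet> \<phi> (Z \<omega>)
      = (\<Sum>i=1..I. \<Sum>j=1..J. indicator (U i \<inter> V j) \<omega> * (\<phi> (g i) \<bullet> \<phi> (h j)))"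
    if "\<omega> \<in> space M" for \<omega>
    \<comment> \<open>The left sum is pulled out before the right one, which fixes the order of
      summation: \<open>i\<close> outside, \<open>j\<close> inside.\<close>
    unfolding Y_eq[OF that] Z_eq[OF that] inner_sum_left unfolding inner_sum_right
    by (intro sum.cong refl) (simp add: indicator_inter_arith)
  have EYZ: "expectation (\<lambda>\<omega>. \<phi> (Y \<omega>) \<bullet> \<phi> (Z \<omega>))
      = (\<Sum>i=1..I. \<Sum>j=1..J. prob (U i \<inter> V j) * (\<phi> (g i) \<bullet> \<phi> (h j)))"
  proof -
    have int: "integrable M (\<lambda>\<omega>. indicat_real (U i \<inter> V j) \<omega> * (\<phi> (g i) \<bullet> \<phi> (h j)))" for i j
      by (intro integrable_mult_left) (auto simp: emeasure_eq_measure)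
    have "expectation (\<lambda>\<omega>. \<phi> (Y \<omega>) \<bullet> \<phi> (Z \<omega>)) = (\<Sum>i=1..I. \<Sum>j=1..J.
        expectation (\<lambda>\<omega>. indicat_real (U i \<inter> V j) \<omega> * (\<phi> (g i) \<bullet> \<phi> (h j))))"
      by (simp only: Bochner_Integration.integral_cong[OF refl YZ_eq]
          Bochner_Integration.integral_sum Bochner_Integration.integrable_sum int)
    also have "\<dots> = (\<Sum>i=1..I. \<Sum>j=1..J. prob (U i \<inter> V j) * (\<phi> (g i) \<bullet> \<phi> (h j)))"
      by (intro sum.cong refl, subst Bochner_Integration.integral_mult_left) (auto simp: emeasure_eq_measure)
    finally show ?thesis .
  qed
  have "expectation (\<lambda>\<omega>. \<phi> (Y \<omega>) \<bullet> \<phi> (Z \<omega>))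
            - expectation (\<lambda>\<omega>. \<phi> (Y \<omega>)) \<bullet> expectation (\<lambda>\<omega>. \<phi> (Z \<omega>))
      = (\<Sum>i=1..I. \<Sum>j=1..J.
          (\<phi> (g i) \<bullet> \<phi> (h j)) * (prob (U i \<inter> V j) - prob (U i) * prob (V j)))"
    unfolding EY EZ EYZ inner_sum_left unfolding inner_sum_right sum_subtractf[symmetric]
    by (intro sum.cong refl) (simp add: algebra_simps)
  also have "\<bar>\<dots>\<bar> \<le> beta_coeff M \<A> \<B>"
    by (rule weighted_sum_le_beta_coeff[OF assms(1,2) U V]) (use \<phi> in auto)
  finally show ?thesis .
qed

text \<open>Approximating the identity of the state space, rather than \<open>Y\<close> and
  \<open>Z\<close> themselves, keeps the approximants functions of \<open>Y\<close> and of
  \<open>Z\<close>, hence measurable for the same sigma-algebras. The bound for simple variables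
  then holds for every \<open>n\<close> with one right-hand side and survives the limit.\<close>

lemma covariance_le_beta_coeff:
  fixes \<phi> :: "'x::{metric_space, second_countable_topology} \<Rightarrow>
                'h::{real_inner, banach, second_countable_topology}"
  assumes "\<A> \<subseteq> events" "\<B> \<subseteq> events"
    and [measurable]: "Y \<in> borel_measurable M" "Z \<in> borel_measurable M"
    and Y: "\<And>B. B \<in> sets borel \<Longrightarrow> Y -` B \<inter> space M \<in> \<A>"
    and Z: "\<And>B. B \<in> sets borel \<Longrightarrow> Z -` B \<inter> space M \<in> \<B>"
    and cont: "continuous_on UNIV \<phi>"
    and \<phi>: "\<And>x y. 0 \<le> \<phi> x \<bullet> \<phi> y" "\<And>x y. \<phi> x \<bullet> \<phi> y \<le> 1"
  shows "\<bar>expectation (\<lambda>\<omega>. \<phi> (Y \<omega>) \<bullet> \<phi> (Z \<omega>))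
            - expectation (\<lambda>\<omega>. \<phi> (Y \<omega>)) \<bullet> expectation (\<lambda>\<omega>. \<phi> (Z \<omega>))\<bar> \<le> beta_coeff M \<A> \<B>"
proof -
  \<comment> \<open>The state space is a separable metric space, so its identity map is a pointwise
    limit of simple functions; \<open>undefined\<close> serves as an arbitrary base point.\<close>
  obtain s :: "nat \<Rightarrow> 'x \<Rightarrow> 'x" where s: "\<And>n. simple_function borel (s n)"
    and lim: "\<And>x. (\<lambda>n. s n x) \<longlonglongrightarrow> x"
    using borel_measurable_implies_sequence_metric[of "\<lambda>x. x" borel undefined] by auto
  have [measurable]: "\<phi> \<in> borel_measurable borel"
    by (rule borel_measurable_continuous_onI[OF cont])
  have [measurable]: "s n \<in> borel_measurable borel" for n
    by (rule borel_measurable_simple_function[OF s])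
  have lim_\<phi>: "(\<lambda>n. \<phi> (s n x)) \<longlonglongrightarrow> \<phi> x" for x
    using continuous_on_tendsto_compose[OF cont lim] by simp
  have norm_\<phi>: "norm (\<phi> x) \<le> 1" for x
    using \<phi>(2)[of x x] by (simp add: norm_eq_sqrt_inner)
  have bound: "\<bar>expectation (\<lambda>\<omega>. \<phi> (s n (Y \<omega>)) \<bullet> \<phi> (s n (Z \<omega>)))
      - expectation (\<lambda>\<omega>. \<phi> (s n (Y \<omega>))) \<bullet> expectation (\<lambda>\<omega>. \<phi> (s n (Z \<omega>)))\<bar>
        \<le> beta_coeff M \<A> \<B>" for n
  proof (rule covariance_simple_le_beta_coeff[where \<phi> = \<phi> and Y = "\<lambda>\<omega>. s n (Y \<omega>)"
        and Z = "\<lambda>\<omega>. s n (Z \<omega>)", OF assms(1,2) _ _ _ _ \<phi>])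
    \<comment> \<open>The values of \<open>s n (Y \<omega>)\<close> lie in the finite range of
      \<open>s n\<close>, and a measurable function with finite range is simple.\<close>
    show "simple_function M (\<lambda>\<omega>. s n (Y \<omega>))" "simple_function M (\<lambda>\<omega>. s n (Z \<omega>))"
      using simple_functionD(1)[OF s, of n]
      by (auto intro!: simple_function_borel_measurable elim: finite_subset[rotated])
    have "s n -` {y} \<in> sets borel" for y
      using simple_functionD(2)[OF s, of n "{y}"] by simp
    from Y[OF this] Z[OF this]
    show "(\<lambda>\<omega>. s n (Y \<omega>)) -` {y} \<inter> space M \<in> \<A>"
      "(\<lambda>\<omega>. s n (Z \<omega>)) -` {y} \<inter> space M \<in> \<B>" for y
      by (simp_all add: vimage_def)
  qed
  \<comment> \<open>The constant 1 dominates the feature vectors since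
    \<open>norm (\<phi> x) \<le> 1\<close>, and is integrable on a probability space.\<close>
  have lim_mean: "(\<lambda>n. expectation (\<lambda>\<omega>. \<phi> (s n (W \<omega>)))) \<longlonglongrightarrow> expectation (\<lambda>\<omega>. \<phi> (W \<omega>))"
    if [measurable]: "W \<in> borel_measurable M" for W
    by (rule integral_dominated_convergence[where w = "\<lambda>_. 1"]) (auto simp: lim_\<phi> norm_\<phi>)
  have lim_inner: "(\<lambda>n. expectation (\<lambda>\<omega>. \<phi> (s n (Y \<omega>)) \<bullet> \<phi> (s n (Z \<omega>))))
      \<longlonglongrightarrow> expectation (\<lambda>\<omega>. \<phi> (Y \<omega>) \<bullet> \<phi> (Z \<omega>))"
    by (rule integral_dominated_convergence[where w = "\<lambda>_. 1"])
      (auto simp: lim_\<phi> \<phi> intro!: tendsto_inner)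
  have "(\<lambda>n. \<bar>expectation (\<lambda>\<omega>. \<phi> (s n (Y \<omega>)) \<bullet> \<phi> (s n (Z \<omega>)))
      - expectation (\<lambda>\<omega>. \<phi> (s n (Y \<omega>))) \<bullet> expectation (\<lambda>\<omega>. \<phi> (s n (Z \<omega>)))\<bar>)
    \<longlonglongrightarrow> \<bar>expectation (\<lambda>\<omega>. \<phi> (Y \<omega>) \<bullet> \<phi> (Z \<omega>))
            - expectation (\<lambda>\<omega>. \<phi> (Y \<omega>)) \<bullet> expectation (\<lambda>\<omega>. \<phi> (Z \<omega>))\<bar>"
    by (intro tendsto_rabs tendsto_diff tendsto_inner lim_inner lim_mean assms(3,4))
  then show ?thesis by (rule LIMSEQ_le_const2) (use bound in auto)
qed

lemma expectation_centred_inner: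
  fixes f g :: "'a \<Rightarrow> 'h::{real_inner, banach, second_countable_topology}"
  assumes "integrable M f" "integrable M g" "integrable M (\<lambda>\<omega>. f \<omega> \<bullet> g \<omega>)"
  shows "expectation (\<lambda>\<omega>. (f \<omega> - expectation f) \<bullet> (g \<omega> - expectation g))
           = expectation (\<lambda>\<omega>. f \<omega> \<bullet> g \<omega>) - expectation f \<bullet> expectation g"
proof -
  \<comment> \<open>The terms are grouped so that the second bracket has expectation zero.\<close>
  have "expectation (\<lambda>\<omega>. (f \<omega> - expectation f) \<bullet> (g \<omega> - expectation g))
      = expectation (\<lambda>\<omega>. f \<omega> \<bullet> g \<omega> - f \<omega> \<bullet> expectation g
          - (expectation f \<bullet> g \<omega> - expectation f \<bullet> expectation g))"
    by (simp only: inner_diff_left inner_diff_right diff_diff_eq2 add_diff_eq diff_add_eq diff_diff_eq add_ac)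
  also have "\<dots> = expectation (\<lambda>\<omega>. f \<omega> \<bullet> g \<omega>) - expectation f \<bullet> expectation g
      - (expectation f \<bullet> expectation g - expectation f \<bullet> expectation g)"
    using assms by (simp add: prob_space)
  finally show ?thesis by simp
qed

end

section \<open>Sigma-algebras generated by the process\<close>

lemma process_sigma_subset_sets:
  assumes "\<And>t. t \<in> T \<Longrightarrow> X t \<in> borel_measurable M"
  shows "process_sigma M X T \<subseteq> sets M"
proof -
  have "X t -` B \<inter> space M \<in> sets M" if "t \<in> T" "B \<in> sets borel" for t B
    using measurable_sets[OF assms[OF that(1)] that(2)] .
  then show ?thesis unfolding process_sigma_def by (intro sets.sigma_sets_subset) blast
qed

lemma process_sigma_mono: "S \<subseteq> T \<Longrightarrow> process_sigma M X S \<subseteq> process_sigma M X T"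
  unfolding process_sigma_def by (rule sigma_sets_mono') blast

lemma space_in_process_sigma: "space M \<in> process_sigma M X T"
  unfolding process_sigma_def by (rule sigma_sets_top)

lemma vimage_in_process_sigma:
  assumes "t \<in> T" "B \<in> sets borel"
  shows "X t -` B \<inter> space M \<in> process_sigma M X T"
  unfolding process_sigma_def using assms by (intro sigma_sets.Basic) blast

section \<open>Inner products and continuity of the feature map\<close>

text \<open>The reproducing property is applied to a section itself; as \<open>k x\<close> lies in
  the range of \<iota>, the inverse in \<open>kernel_section\<close> is undone by \<iota>.\<close>

lemma inner_kernel_section:
  assumes "is_rkhs k \<iota>"
  shows "kernel_section k \<iota> x \<bullet> kernel_section k \<iota> y = k x y"
proof -
  have "\<iota> (kernel_section k \<iota> x) = k x"
    using assms unfolding is_rkhs_def kernel_section_def by (simp add: f_inv_into_f)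
  with assms show ?thesis unfolding is_rkhs_def by metis
qed

text \<open>Dominated convergence, with the absolute value of \<open>f\<close> on the half-line from
  0 as the dominating function. It provides the right continuity of \<open>F\<close> at 0.\<close>

lemma tendsto_tail_integral:
  fixes f :: "real \<Rightarrow> real"
  assumes f: "set_integrable lborel {0..} f"
    and a: "a \<longlonglongrightarrow> 0" "\<And>n. 0 \<le> a n"
  shows "(\<lambda>n. LBINT b:{a n..}. f b) \<longlonglongrightarrow> (LBINT b:{0..}. f b)"
  unfolding set_lebesgue_integral_def
proof (rule integral_dominated_convergence[where w = "\<lambda>b. norm (indicat_real {0..} b *\<^sub>R f b)"])
  show "integrable lborel (\<lambda>b. norm (indicat_real {0..} b *\<^sub>R f b))"
    using f unfolding set_integrable_def by (rule integrable_norm)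
  show [measurable]: "(\<lambda>b. indicat_real {0..} b *\<^sub>R f b) \<in> borel_measurable lborel"
    using f unfolding set_integrable_def by (rule borel_measurable_integrable)
  \<comment> \<open>Measurability of \<open>f\<close> is known only after cutting off at 0. As
    \<open>a n\<close> is nonnegative, the integrand is a further cutoff of that measurable
    function.\<close>
  have "indicat_real {a n..} b *\<^sub>R f b = indicat_real {a n..} b *\<^sub>R (indicat_real {0..} b *\<^sub>R f b)"
    for n b using a(2)[of n] by (auto simp: indicator_def)
  then show "(\<lambda>b. indicat_real {a n..} b *\<^sub>R f b) \<in> borel_measurable lborel" for n
    by (simp only:) measurable
  show "AE b in lborel. norm (indicat_real {a n..} b *\<^sub>R f b)
      \<le> norm (indicat_real {0..} b *\<^sub>R f b)" for n
    using a(2)[of n] by (auto simp: indicator_def)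
  \<comment> \<open>The point 0 is left out: it lies in \<open>{0..}\<close> but in no
    \<open>{a n..}\<close> with \<open>a n\<close> positive, so convergence may fail there. It is a
    null set. At every other point the indicators are eventually equal.\<close>
  have "(\<lambda>n. indicat_real {a n..} b *\<^sub>R f b) \<longlonglongrightarrow> indicat_real {0..} b *\<^sub>R f b" if "b \<noteq> 0" for b
  proof (rule tendsto_eventually)
    show "\<forall>\<^sub>F n in sequentially. indicat_real {a n..} b *\<^sub>R f b = indicat_real {0..} b *\<^sub>R f b"
    proof (cases "b > 0")
      case True
      from order_tendstoD(2)[OF a(1) this] show ?thesis
        by eventually_elim (use True in \<open>auto simp: indicator_def\<close>)
    next
      case False
      then show ?thesis using that less_le_trans[OF _ a(2), of b]
        by (auto simp: indicator_def not_le)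
    qed
  qed
  then show "AE b in lborel. (\<lambda>n. indicat_real {a n..} b *\<^sub>R f b)
      \<longlonglongrightarrow> indicat_real {0..} b *\<^sub>R f b"
    by (intro AE_mp[OF AE_lborel_singleton[of 0] AE_I2] impI)
qed

text \<open>Distances of feature vectors depend on \<open>F\<close> only through
  \<open>F 0 - F (norm (y - z))\<close>, so right continuity of \<open>F\<close> at 0, stated by
  sequences, gives continuity everywhere.\<close>

lemma continuous_kernel_section_radial:
  fixes k :: "'x::real_normed_vector \<Rightarrow> 'x \<Rightarrow> real"
  assumes "is_rkhs k \<iota>"
    and k: "\<And>x y. k x y = F (norm (x - y))"
    and F: "\<And>a. (\<And>n. 0 \<le> a n) \<Longrightarrow> a \<longlonglongrightarrow> 0 \<Longrightarrow> (\<lambda>n. F (a n)) \<longlonglongrightarrow> F 0"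
  shows "continuous_on UNIV (kernel_section k \<iota>)"
  unfolding continuous_on_sequentially
proof (intro ballI allI impI, elim conjE)
  let ?\<phi> = "kernel_section k \<iota>"
  fix u :: "nat \<Rightarrow> 'x" and x assume u: "u \<longlonglongrightarrow> x"
  have "norm (?\<phi> y - ?\<phi> z) = sqrt (2 * F 0 - 2 * F (norm (y - z)))" for y z
    unfolding norm_eq_sqrt_inner inner_diff_left inner_diff_right inner_kernel_section[OF assms(1)]
    by (simp add: k norm_minus_commute)
  moreover have "(\<lambda>n. norm (u n - x)) \<longlonglongrightarrow> 0"
    using u by (simp add: LIM_zero tendsto_norm_zero)
  then have "(\<lambda>n. sqrt (2 * F 0 - 2 * F (norm (u n - x)))) \<longlonglongrightarrow> sqrt (2 * F 0 - 2 * F 0)"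
    by (intro tendsto_intros F) auto
  ultimately have "(\<lambda>n. norm (?\<phi> (u n) - ?\<phi> x)) \<longlonglongrightarrow> 0" by simp
  then show "(?\<phi> \<circ> u) \<longlonglongrightarrow> ?\<phi> x"
    unfolding comp_def by (metis LIM_zero_cancel tendsto_norm_zero_cancel)
qed

section \<open>The two inequalities for the stationary process\<close>

theorem proposition4p4:
  fixes k :: "real ^ 'd \<Rightarrow> real ^ 'd \<Rightarrow> real"
    and \<iota> :: "'h::{real_inner, banach, second_countable_topology} \<Rightarrow> real ^ 'd \<Rightarrow> real"
    and f F :: "real \<Rightarrow> real"
    and M :: "'w measure" and X :: "int \<Rightarrow> 'w \<Rightarrow> real ^ 'd" and P0 :: "(real ^ 'd) measure"
  assumes "pos_def_kernel k"
    and "is_rkhs k \<iota>"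
    and "characteristic_kernel k \<iota>"
    and "\<forall>x y. \<bar>k x y\<bar> \<le> 1"
    and "prob_space M"
    and "strictly_stationary M X"
    and "\<forall>t. distr M borel (X t) = P0"
    and "continuous_on {0..} f"
    and "\<forall>b\<ge>0. 0 \<le> f b"
    and "set_integrable lborel {0..} f"
    and "(LBINT b:{0..}. f b) = 1"
    and "\<forall>a\<ge>0. F a = (LBINT b:{a..}. f b)"
    and "\<forall>x y. k x y = F (norm (x - y))"
  shows "\<forall>t\<ge>1. rho_coeff k \<iota> P0 M X t
                  \<le> beta_coeff M (process_sigma M X {0}) (process_sigma M X {t}) \<and>
               beta_coeff M (process_sigma M X {0}) (process_sigma M X {t})
                  \<le> beta_mixing M X t"
proof (intro allI impI)
  fix t :: int assume "t \<ge> 1"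
  let ?\<phi> = "kernel_section k \<iota>"
  interpret prob_space M by (rule assms(5))
  have [measurable]: "X s \<in> borel_measurable M" for s
    using assms(6) unfolding strictly_stationary_def by blast
  have sub: "process_sigma M X T \<subseteq> events" for T
    by (rule process_sigma_subset_sets) simp
  \<comment> \<open>The tail integral starts at a norm, so it sees only arguments where
    \<open>f\<close> is nonnegative.\<close>
  have k_nonneg: "0 \<le> k x y" for x y
  proof -
    have "0 \<le> (LBINT b:{norm (x - y)..}. f b)"
      unfolding set_lebesgue_integral_def
      using assms(9) order_trans[OF norm_ge_zero[of "x - y"]]
      by (intro integral_nonneg_AE AE_I2) (auto simp: indicator_def)
    then show ?thesis using assms(12,13) by simp
  qed
  have k_le: "k x y \<le> 1" for x y
    using assms(4)[rule_format, of x y] by linarith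
  have cont: "continuous_on UNIV ?\<phi>"
  proof (rule continuous_kernel_section_radial[OF assms(2)])
    show "k x y = F (norm (x - y))" for x y using assms(13) by simp
    show "(\<lambda>n. F (a n)) \<longlonglongrightarrow> F 0" if "\<And>n. 0 \<le> a n" "a \<longlonglongrightarrow> 0" for a
      using tendsto_tail_integral[OF assms(10) that(2,1)] that(1) assms(12) by simp
  qed
  have [measurable]: "?\<phi> \<in> borel_measurable borel"
    by (rule borel_measurable_continuous_onI[OF cont])
  have "norm (?\<phi> x) \<le> 1" for x
    using k_le[of x x] by (simp add: norm_eq_sqrt_inner inner_kernel_section[OF assms(2)])
  then have int: "integrable M (\<lambda>\<omega>. ?\<phi> (X s \<omega>))" for s
    by (intro integrable_const_bound[of _ 1]) auto
  have int2: "integrable M (\<lambda>\<omega>. ?\<phi> (X t \<omega>) \<bullet> ?\<phi> (X 0 \<omega>))"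
  proof (rule integrable_const_bound[of _ 1])
    show "AE \<omega> in M. norm (?\<phi> (X t \<omega>) \<bullet> ?\<phi> (X 0 \<omega>)) \<le> 1"
      by (simp add: inner_kernel_section[OF assms(2)] k_nonneg k_le)
  qed measurable
  \<comment> \<open>All marginals equal \<open>P0\<close>, so one embedding is the mean at time
    \<open>t\<close> and at time 0. Each factor in \<open>rho_coeff\<close> is thus centred at its
    own mean, and the coefficient is the absolute value of a covariance.\<close>
  have mean: "mean_embedding k \<iota> P0 = expectation (\<lambda>\<omega>. ?\<phi> (X s \<omega>))" for s
    unfolding mean_embedding_def assms(7)[rule_format, of s, symmetric]
    by (rule integral_distr) measurable
  \<comment> \<open>Symmetry of the inner product puts time 0 first, matching the order of the two
    sigma-algebras in \<open>beta_coeff\<close>.\<close>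
  have "rho_coeff k \<iota> P0 M X t = \<bar>expectation (\<lambda>\<omega>. ?\<phi> (X 0 \<omega>) \<bullet> ?\<phi> (X t \<omega>))
      - expectation (\<lambda>\<omega>. ?\<phi> (X 0 \<omega>)) \<bullet> expectation (\<lambda>\<omega>. ?\<phi> (X t \<omega>))\<bar>"
    using expectation_centred_inner[OF int int int2]
    unfolding rho_coeff_def mean[of t, symmetric] mean[of 0, symmetric]
    by (simp add: inner_commute)
  also have "\<dots> \<le> beta_coeff M (process_sigma M X {0}) (process_sigma M X {t})"
    by (rule covariance_le_beta_coeff[OF sub sub])
      (auto intro: vimage_in_process_sigma cont
        simp: inner_kernel_section[OF assms(2)] k_nonneg k_le)
  finally show "rho_coeff k \<iota> P0 M X t
                  \<le> beta_coeff M (process_sigma M X {0}) (process_sigma M X {t}) \<and>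
               beta_coeff M (process_sigma M X {0}) (process_sigma M X {t})
                  \<le> beta_mixing M X t"
    \<comment> \<open>The second inequality is monotonicity: time 0 belongs to the past
      \<open>{..0}\<close> and time \<open>t\<close> to the future \<open>{t..}\<close>.\<close>
    unfolding beta_mixing_def
    by (intro conjI beta_coeff_mono sub space_in_process_sigma process_sigma_mono) auto
qed

end
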